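(* Let $k\leq\min\{n,m\}$ and let $P$ be an $n\times m$ non-negative real matrix with $\mathrm{rk}_+(P)=k$. Suppose that $P=f_+(p)$ for some point $p\in\mathbb{R}_{\geq 0}^{k(n+m)}$ all of whose coordinates are (strictly) positive and such that the Jacobian matrix $f_+^*(p)$ has maximal rank, i.e. rank $k(n+m-k)$. Then there exists $\epsilon>0$ such that for each $N\in B(P,\epsilon)$: if $\mathrm{rk}(N)=\mathrm{rk}(P)$, then $\mathrm{rk}_+(N)=\mathrm{rk}_+(P)$.
   Context: A non-negative $n\times m$ matrix is a real matrix $(p_{i,j})$ with all entries $p_{i,j}\ge 0$; the set of these is denoted $\mathbb{R}^{nm}_{\geq 0}$. $\mathrm{rk}$ denotes the ordinary rank. The non-negative rank $\mathrm{rk}_+(P)$ of a non-negative $n\times m$ matrix $P$ is the smallest integer $k$ such that $P=c_1(r_1)^t+\ldots+c_k(r_k)^t$, where the column vectors $c_h\in\mathbb{R}^n$ and $r_h\in\mathbb{R}^m$ have non-negative entries. For a non-negative matrix $P=(p_{i,j})$ and $\epsilon>0$, $$B(P,\epsilon)=\left\{N=(n_{i,j})\in\mathbb{R}^{nm}_{\geq 0} : \sqrt{\sum_{i,j} (p_{i,j}-n_{i,j})^2}<\epsilon\right\}.$$ Let $f:\mathbb{R}^{k(n+m)}\to\mathbb{R}^{nm}$ be the map sending the point $$p=(x_{1,1},\dots,x_{1,n},y_{1,1},\dots,y_{1,m},\dots,x_{k,1},\dots,x_{k,n},y_{k,1},\dots,y_{k,m})$$ to the $n\times m$ matrix $$f(p)=\sum_{h=1}^k\begin{pmatrix}x_{h,1}\\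 \vdots\\ x_{h,n}\end{pmatrix}\begin{pmatrix}y_{h,1}&\dots&y_{h,m}\end{pmatrix}.$$ Its image lies in the variety $X_{n\times m,k}$ of $n\times m$ real matrices of rank at most $k$, which has dimension $k(n+m-k)$. Let $f_+$ be the restriction of $f$ to the non-negative orthant $\mathbb{R}_{\geq 0}^{k(n+m)}$, and let $f_+^*(p)$ be the Jacobian matrix of $f_+$ at $p$ (the matrix of all first-order partial derivatives with respect to the variables $x_{h,i}$ and $y_{h,j}$). One says that $f_+^*(p)$ has maximal rank if its rank is $k(n+m-k)$. *)

theory Defs
  imports "HOL-Analysis.Derivative" "Jordan_Normal_Form.DL_Rank"
begin

definition nonneg_mat :: "real mat \<Rightarrow> bool" where
  "nonneg_mat A \<longleftrightarrow> (\<forall>i < dim_row A. \<forall>j < dim_col A. A $$ (i, j) \<ge> 0)"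

definition nonneg_vec :: "real vec \<Rightarrow> bool" where
  "nonneg_vec v \<longleftrightarrow> (\<forall>i < dim_vec v. v $ i \<ge> 0)"

definition mat_rank :: "real mat \<Rightarrow> nat" where
  "mat_rank A = vec_space.rank (dim_row A) A"

text \<open>A non-negative matrix always has such a decomposition (one term per column), so that
  the least number is attained. For matrices with a negative entry the value is irrelevant.\<close>

definition nonneg_rank :: "real mat \<Rightarrow> nat" where
  "nonneg_rank A = (LEAST k. \<exists>c r.
     (\<forall>h < k. c h \<in> carrier_vec (dim_row A) \<and> nonneg_vec (c h) \<and>
              r h \<in> carrier_vec (dim_col A) \<and> nonneg_vec (r h)) \<and>
     A = mat (dim_row A) (dim_col A) (\<lambda>(i, j). \<Sum>h<k. c h $ i * r h $ j))"

definition nonneg_ball :: "real mat \<Rightarrow> real \<Rightarrow> real mat set" where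
  "nonneg_ball A e = {N \<in> carrier_mat (dim_row A) (dim_col A). nonneg_mat N \<and>
     sqrt (\<Sum>i<dim_row A. \<Sum>j<dim_col A. (A $$ (i, j) - N $$ (i, j))\<^sup>2) < e}"

text \<open>A point of the space of dimension \<open>k * (n + m)\<close> consists of \<open>k\<close> consecutive blocks, the
  block \<open>h\<close> listing first \<open>x\<^sub>h\<close> (\<open>n\<close> coordinates) and then \<open>y\<^sub>h\<close> (\<open>m\<close> coordinates); all indices
  start at 0.\<close>

definition x_coord :: "nat \<Rightarrow> nat \<Rightarrow> real vec \<Rightarrow> nat \<Rightarrow> nat \<Rightarrow> real" where
  "x_coord n m p h i = p $ (h * (n + m) + i)"

definition y_coord :: "nat \<Rightarrow> nat \<Rightarrow> real vec \<Rightarrow> nat \<Rightarrow> nat \<Rightarrow> real" where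
  "y_coord n m p h j = p $ (h * (n + m) + n + j)"

definition factor_map :: "nat \<Rightarrow> nat \<Rightarrow> nat \<Rightarrow> real vec \<Rightarrow> real mat" where
  "factor_map n m k p = mat n m (\<lambda>(i, j). \<Sum>h<k. x_coord n m p h i * y_coord n m p h j)"

text \<open>Rows are indexed by the matrix entries \<open>(i, j)\<close> in the order \<open>i * m + j\<close>, columns by the
  coordinates of \<open>p\<close>. The partial derivatives are those of the map on the whole space; at a
  point with positive coordinates, which is interior to the non-negative orthant, they
  agree with the partial derivatives of the restriction to the orthant.\<close>

definition jacobian :: "nat \<Rightarrow> nat \<Rightarrow> nat \<Rightarrow> real vec \<Rightarrow> real mat" where
  "jacobian n m k p = mat (n * m) (k * (n + m)) (\<lambda>(r, v).
     deriv (\<lambda>t. factor_map n m k (vec (k * (n + m)) (\<lambda>w. if w = v then t else p $ w))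
                  $$ (r div m, r mod m)) (p $ v))"

end

theory Submission
  imports Defs
begin

text \<open>The rank of \<open>N\<close> enters only as an upper bound on \<open>rk\<^sub>+\<close>; the lower bound holds for every non-negative
matrix near \<open>P\<close>. Both are proved along sequences, because a failure of the claim for every
\<open>\<epsilon>\<close> yields matrices \<open>N t\<close> that converge to \<open>P\<close>.

Lower bound: a non-negative factorization can be rescaled so that all its entries are bounded in
terms of the factored matrix. By compactness the matrices with \<open>rk\<^sub>+ \<le> d\<close> form a closed set, so
\<open>rk\<^sub>+\<close> is lower semicontinuous (\<open>nonneg_rank_lower_semicontinuous\<close>).

Upper bound: \<open>rk\<^sub>+(N) \<le> min n m\<close> always holds, which settles \<open>k = n\<close> and \<open>k = m\<close>. Let \<open>k < n\<close>
and \<open>k < m\<close>, and write \<open>P = X Y\<close> with the factors read off from \<open>p\<close>. The image of the Jacobian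
consists of the matrices \<open>A Y + X B\<close>. In suitable bases its elements have a common block of zeros of
size \<open>(n - rk X) (m - rk Y)\<close>, so that the Jacobian has rank at most
\<open>n m - (n - rk X) (m - rk Y)\<close>; the value \<open>k (n + m - k) = n m - (n - k) (m - k)\<close> therefore
forces \<open>rk X = rk Y = k\<close> (\<open>factors_one_sided_invertible\<close>). Choose \<open>L\<close> and \<open>R\<close> with \<open>L X = 1\<close>
and \<open>Y R = 1\<close>. A matrix \<open>N\<close> of rank at most \<open>k\<close> for which \<open>L N R\<close> is invertible satisfies
\<open>N = (N R (L N R)\<^bsup>-1\<^esup>) (L N)\<close> (\<open>factorization_from_projections\<close>). As \<open>N\<close> tends to \<open>P\<close>, the matrix
\<open>L N R\<close> tends to \<open>1\<close> and the two factors tend to \<open>X\<close> and \<open>Y\<close>. These have positive entries, so the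
factors of \<open>N\<close> are eventually positive too. This explicit formula takes the place of the implicit
function theorem.\<close>

section \<open>Rank and factorizations\<close>

lemma mult_mat_index:
  assumes "A \<in> carrier_mat n c" "B \<in> carrier_mat c m" "i < n" "j < m"
  shows "(A * B) $$ (i, j) = (\<Sum>h<c. A $$ (i, h) * B $$ (h, j))"
  using assms by (auto simp: scalar_prod_def atLeast0LessThan intro!: sum.cong)

lemma rank_le_of_sum_of_products:
  fixes A :: "real mat" and f :: "nat \<Rightarrow> nat \<Rightarrow> real"
  assumes "A \<in> carrier_mat n m"
    and "\<And>i j. i < n \<Longrightarrow> j < m \<Longrightarrow> A $$ (i, j) = (\<Sum>h<d. f i h * g h j)"
  shows "vec_space.rank n A \<le> d"
  using assms
proof (induction d arbitrary: A)
  case 0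
  have "A = 0\<^sub>m n m" using 0 by (intro eq_matI) auto
  then show ?case by (simp add: vec_space.rank_0I)
next
  case (Suc d)
  define B where "B = mat n m (\<lambda>(i, j). \<Sum>h<d. f i h * g h j)"
  define C where "C = mat n m (\<lambda>(i, j). f i d * g d j)"
  have B: "B \<in> carrier_mat n m" and C: "C \<in> carrier_mat n m"
    by (auto simp: B_def C_def)
  have "A = B + C"
    using Suc.prems by (intro eq_matI) (auto simp: B_def C_def)
  then have "vec_space.rank n A \<le> vec_space.rank n B + vec_space.rank n C"
    using vec_space.rank_subadditive[OF B C] by simp
  also have "vec_space.rank n B \<le> d"
    by (rule Suc.IH[OF B]) (simp add: B_def)
  also have "vec_space.rank n C \<le> 1"
    by (rule vec_space.rank_le_1_product_entries[OF C, of "\<lambda>i. f i d" "\<lambda>j. g d j"])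
      (simp add: C_def)
  finally show ?case by simp
qed

text \<open>A maximal linearly independent set of columns serves as the left factor, padded with zero columns
up to the prescribed inner dimension \<open>d\<close>.\<close>

lemma rank_factorization:
  fixes A :: "real mat"
  assumes A: "A \<in> carrier_mat n m" and r: "vec_space.rank n A \<le> d"
  obtains B C where "B \<in> carrier_mat n d" "C \<in> carrier_mat d m" "A = B * C"
proof -
  interpret vec_space "TYPE(real)" n .
  obtain U where U: "finite U" "maximal U (\<lambda>T. T \<subseteq> set (cols A) \<and> lin_indpt T)"
    using maximal_exists_superset[of "set (cols A)" "\<lambda>T. T \<subseteq> set (cols A) \<and> lin_indpt T" "{}"]
    by (auto simp: lin_dep_def)
  have card: "rank A = card U" by (rule rank_card_indpt[OF A U(2)])
  have sub: "U \<subseteq> set (cols A)" and indpt: "lin_indpt U"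
    using U(2) by (auto simp: maximal_def)
  have cA: "set (cols A) \<subseteq> carrier_vec n" using A cols_dim by blast
  have Uc: "U \<subseteq> carrier_vec n" using sub cA by blast
  have "\<exists>a. col A j = lincomb a U" if j: "j < m" for j
  proof -
    have cj: "col A j \<in> set (cols A)" using j A by (auto simp: cols_def)
    have "col A j \<in> span U"
    proof (rule ccontr)
      assume n: "col A j \<notin> span U"
      then have nU: "col A j \<notin> U" using Uc span_mem by blast
      have "lin_indpt (U \<union> {col A j})"
        using lin_dep_iff_in_span[OF _ indpt _ nU] Uc cj cA n by auto
      moreover note nU
      ultimately show False
        using U(2) cj sub unfolding maximal_def by blast
    qed
    then show ?thesis using U(1) Uc by (auto simp: finite_span)
  qed
  then obtain a where a: "\<And>j. j < m \<Longrightarrow> col A j = lincomb (a j) U" by metis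
  obtain e where e: "bij_betw e {..<card U} U"
    using ex_bij_betw_nat_finite[OF U(1)] by (auto simp: atLeast0LessThan)
  define B where "B = mat n d (\<lambda>(i, h). if h < card U then e h $ i else 0)"
  define C where "C = mat d m (\<lambda>(h, j). a j (e h))"
  have B: "B \<in> carrier_mat n d" and C: "C \<in> carrier_mat d m" by (auto simp: B_def C_def)
  have "A = B * C"
  proof (rule eq_matI)
    fix i j assume "i < dim_row (B * C)" "j < dim_col (B * C)"
    then have i: "i < n" and j: "j < m" by (auto simp: B_def C_def)
    have "A $$ (i, j) = col A j $ i" using A i j by simp
    also have "\<dots> = (\<Sum>x\<in>U. a j x * x $ i)" using a[OF j] lincomb_index[OF i Uc] by simp
    also have "\<dots> = (\<Sum>h<card U. a j (e h) * e h $ i)"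
      using sum.reindex_bij_betw[OF e, of "\<lambda>x. a j x * x $ i"] by simp
    also have "\<dots> = (\<Sum>h<d. B $$ (i, h) * C $$ (h, j))"
      using r card i j by (intro sum.mono_neutral_cong_left) (auto simp: B_def C_def)
    finally show "A $$ (i, j) = (B * C) $$ (i, j)"
      using mult_mat_index[OF B C i j] by simp
  qed (use A in \<open>auto simp: B_def C_def\<close>)
  then show ?thesis using that B C by blast
qed

text \<open>The number \<open>a\<close> replaces the rank of \<open>A\<close>, of which only two properties matter: an invertible
\<open>T\<close> moves the column space into the first \<open>a\<close> coordinates, and \<open>A\<close> has a left inverse when \<open>a\<close>
attains its maximum \<open>k\<close>. For these it suffices to take \<open>a = k - 1\<close> for every deficient \<open>A\<close>,
however small its rank. The matrix \<open>T\<close> comes from Gauss-Jordan elimination.\<close>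

lemma row_reduction_or_left_inverse:
  fixes A :: "real mat"
  assumes A: "A \<in> carrier_mat n k" and kn: "k \<le> n"
  obtains T T' a where "T \<in> carrier_mat n n" "T' \<in> carrier_mat n n" "T' * T = 1\<^sub>m n"
    "a \<le> k" "\<And>i j. a \<le> i \<Longrightarrow> i < n \<Longrightarrow> j < k \<Longrightarrow> (T * A) $$ (i, j) = 0"
    "a < k \<or> (\<exists>L \<in> carrier_mat k n. L * A = 1\<^sub>m k)"
proof -
  define E where "E = gauss_jordan_single A"
  note gj = gauss_jordan_single[OF A E_def[symmetric]]
  obtain T T' where T: "E = T * A" "T \<in> carrier_mat n n" "T' \<in> carrier_mat n n" "T' * T = 1\<^sub>m n"
    using gj(4) by blast
  have E: "E \<in> carrier_mat n k" by (rule gj(2))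
  obtain f where f: "pivot_fun E f k" using gj(3) E by (auto simp: row_echelon_form_def)
  have dE: "dim_row E = n" using E by simp
  note pf = pivot_funD[OF dE f]
  have fge: "f i = k \<or> i \<le> f i" if "i < n" for i
    using pivot_bound[OF dE f, of 0 i] that by auto
  show ?thesis
  proof (cases "k = 0 \<or> f (k - 1) < k")
    case True
    \<comment> \<open>All \<open>k\<close> columns contain a pivot, so the echelon form is the identity on top of zeros,
      and the first \<open>k\<close> rows of \<open>T\<close> form a left inverse.\<close>
    have fi: "f i = i" if "i < k" for i
    proof -
      have "f (k - 1) = k - 1" using fge[of "k - 1"] pf(1)[of "k - 1"] True that kn by force
      moreover have "f (k - 1) = k \<or> f (k - 1) \<ge> (k - 1 - i) + f i"
        using pivot_bound[OF dE f, of i "k - 1 - i"] that kn by auto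
      ultimately have "f i \<le> i" using that by auto
      then show ?thesis using fge[of i] that kn by auto
    qed
    define L where "L = mat k n (\<lambda>(i, j). T $$ (i, j))"
    have L: "L \<in> carrier_mat k n" by (simp add: L_def)
    have "L * A = 1\<^sub>m k"
    proof (rule eq_matI)
      fix i j assume "i < dim_row (1\<^sub>m k :: real mat)" "j < dim_col (1\<^sub>m k :: real mat)"
      then have i: "i < k" and j: "j < k" by auto
      have "(L * A) $$ (i, j) = (\<Sum>h<n. L $$ (i, h) * A $$ (h, j))"
        by (rule mult_mat_index[OF L A i j])
      also have "\<dots> = (\<Sum>h<n. T $$ (i, h) * A $$ (h, j))" using i by (simp add: L_def)
      also have "\<dots> = E $$ (i, j)"
        using mult_mat_index[OF T(2) A, of i j] i j kn T(1) by simp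
      also have "\<dots> = (if i = j then 1 else 0)"
        using pf(4)[of j] pf(5)[of j i] fi[OF j] i j kn by auto
      finally show "(L * A) $$ (i, j) = 1\<^sub>m k $$ (i, j)" using i j by simp
    qed (use L A in auto)
    moreover have "(T * A) $$ (i, j) = 0" if "k \<le> i" "i < n" "j < k" for i j
      using fge[of i] pf(2)[of i j] pf(5)[of j i] fi[of j] that T(1) kn by auto
    ultimately show ?thesis using that[of T T' k] T L by blast
  next
    case False
    \<comment> \<open>Row \<open>k - 1\<close> has no pivot (the pivot function takes its default value \<open>k\<close>), hence neither has
      any later row.\<close>
    have "(T * A) $$ (i, j) = 0" if "k - 1 \<le> i" "i < n" "j < k" for i j
    proof -
      have "f i = k"
      proof (cases "i = k - 1")
        case True then show ?thesis using False pf(1)[of i] that by auto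
      next
        case i: False
        then show ?thesis using fge[of i] pf(1)[of i] that by auto
      qed
      then show ?thesis using pf(2)[of i j] that T(1) by auto
    qed
    then show ?thesis using that[of T T' "k - 1"] T False by auto
  qed
qed

section \<open>The rank of the Jacobian\<close>

definition x_factor :: "nat \<Rightarrow> nat \<Rightarrow> nat \<Rightarrow> real vec \<Rightarrow> real mat" where
  "x_factor n m k p = mat n k (\<lambda>(i, h). x_coord n m p h i)"

definition y_factor :: "nat \<Rightarrow> nat \<Rightarrow> nat \<Rightarrow> real vec \<Rightarrow> real mat" where
  "y_factor n m k p = mat k m (\<lambda>(h, j). y_coord n m p h j)"

lemma factor_carrier [simp]:
  "x_factor n m k p \<in> carrier_mat n k" "y_factor n m k p \<in> carrier_mat k m"
  by (auto simp: x_factor_def y_factor_def)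

lemma factor_map_eq_mult: "factor_map n m k p = x_factor n m k p * y_factor n m k p"
proof (rule eq_matI)
  fix i j assume "i < dim_row (x_factor n m k p * y_factor n m k p)"
    "j < dim_col (x_factor n m k p * y_factor n m k p)"
  then have ij: "i < n" "j < m" by (auto simp: x_factor_def y_factor_def)
  then show "factor_map n m k p $$ (i, j) = (x_factor n m k p * y_factor n m k p) $$ (i, j)"
    using mult_mat_index[OF factor_carrier ij]
    by (simp add: factor_map_def x_factor_def y_factor_def)
qed (auto simp: factor_map_def x_factor_def y_factor_def)

lemma factor_coord_less:
  fixes h k n m :: nat
  assumes "h < k"
  shows "i < n \<Longrightarrow> h * (n + m) + i < k * (n + m)"
    and "j < m \<Longrightarrow> h * (n + m) + n + j < k * (n + m)"
proof -
  have "h * (n + m) + (n + m) \<le> k * (n + m)"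
    using mult_le_mono1[of "Suc h" k "n + m"] assms by simp
  then show "i < n \<Longrightarrow> h * (n + m) + i < k * (n + m)"
    and "j < m \<Longrightarrow> h * (n + m) + n + j < k * (n + m)" by auto
qed

text \<open>The product rule. For each \<open>v\<close> at most one indicator is \<open>1\<close>: the one of the coordinate of \<open>p\<close> with
index \<open>v\<close>.\<close>

lemma jacobian_entry:
  assumes r: "r < n * m" and v: "v < k * (n + m)"
  shows "jacobian n m k p $$ (r, v) =
    (\<Sum>h<k. (if h * (n + m) + r div m = v then 1 else 0) * y_coord n m p h (r mod m)
         + x_coord n m p h (r div m) * (if h * (n + m) + n + r mod m = v then 1 else 0))"
    (is "_ = ?D")
proof -
  have m: "m > 0" using r by (cases m) auto
  define i j where "i = r div m" and "j = r mod m"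
  have i: "i < n" using r by (simp add: i_def less_mult_imp_div_less)
  have j: "j < m" using m by (simp add: j_def)
  define c where "c t w = (if w = v then t else p $ w)" for t :: real and w
  have c: "((\<lambda>t. c t w) has_field_derivative (if w = v then 1 else 0)) (at (p $ v))" for w
    by (cases "w = v") (auto simp: c_def intro!: derivative_eq_intros)
  have cp: "c (p $ v) w = p $ w" for w by (simp add: c_def)
  have *: "factor_map n m k (vec (k * (n + m)) (\<lambda>w. if w = v then t else p $ w)) $$ (i, j)
     = (\<Sum>h<k. c t (h * (n + m) + i) * c t (h * (n + m) + n + j))" for t
    using i j by (simp add: factor_map_def x_coord_def y_coord_def factor_coord_less c_def)
  have "((\<lambda>t. \<Sum>h<k. c t (h * (n + m) + i) * c t (h * (n + m) + n + j))
      has_field_derivative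
        (\<Sum>h<k. (if h * (n + m) + i = v then 1 else 0) * c (p $ v) (h * (n + m) + n + j)
          + (if h * (n + m) + n + j = v then 1 else 0) * c (p $ v) (h * (n + m) + i)))
      (at (p $ v))"
    by (intro DERIV_sum DERIV_mult c)
  then have "deriv (\<lambda>t. \<Sum>h<k. c t (h * (n + m) + i) * c t (h * (n + m) + n + j)) (p $ v)
      = (\<Sum>h<k. (if h * (n + m) + i = v then 1 else 0) * c (p $ v) (h * (n + m) + n + j)
          + (if h * (n + m) + n + j = v then 1 else 0) * c (p $ v) (h * (n + m) + i))"
    by (rule DERIV_imp_deriv)
  also have "\<dots> = ?D"
    unfolding cp i_def[symmetric] j_def[symmetric] x_coord_def y_coord_def
    by (intro sum.cong refl) (simp add: mult.commute)
  finally show ?thesis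
    using r v unfolding jacobian_def by (simp add: i_def[symmetric] j_def[symmetric] *)
qed

text \<open>Column \<open>v\<close> of the Jacobian is the matrix \<open>D v = dX v * Y + X * dY v\<close> written as a vector. The
change of coordinates \<open>D \<mapsto> T * D * S\<close> is invertible and makes all these matrices vanish on the
lower right block \<open>{a..<n} \<times> {b..<m}\<close>: there the first summand is killed by the zero columns of
\<open>Y * S\<close> and the second by the zero rows of \<open>T * X\<close>. The columns of the Jacobian are thus
combinations of as many vectors as there are positions outside the block.\<close>

lemma rank_jacobian_le:
  assumes T: "T \<in> carrier_mat n n" "T' \<in> carrier_mat n n" "T' * T = 1\<^sub>m n"
    and S: "S \<in> carrier_mat m m" "S' \<in> carrier_mat m m" "S * S' = 1\<^sub>m m"
    and TX: "\<And>i h. a \<le> i \<Longrightarrow> i < n \<Longrightarrow> h < k \<Longrightarrow> (T * x_factor n m k p) $$ (i, h) = 0"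
    and YS: "\<And>h j. h < k \<Longrightarrow> b \<le> j \<Longrightarrow> j < m \<Longrightarrow> (y_factor n m k p * S) $$ (h, j) = 0"
  shows "mat_rank (jacobian n m k p) \<le> n * m - (n - a) * (m - b)"
proof -
  define X Y where "X = x_factor n m k p" and "Y = y_factor n m k p"
  have X: "X \<in> carrier_mat n k" and Y: "Y \<in> carrier_mat k m" by (simp_all add: X_def Y_def)
  define dX where "dX v = mat n k (\<lambda>(i, h). if h * (n + m) + i = v then 1 else (0::real))" for v
  define dY where "dY v = mat k m (\<lambda>(h, j). if h * (n + m) + n + j = v then 1 else (0::real))" for v
  have dX: "dX v \<in> carrier_mat n k" and dY: "dY v \<in> carrier_mat k m" for v
    by (auto simp: dX_def dY_def)
  define D where "D v = dX v * Y + X * dY v" for v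
  have D: "D v \<in> carrier_mat n m" for v using dX dY X Y by (auto simp: D_def)
  define M where "M v = T * D v * S" for v
  have M: "M v \<in> carrier_mat n m" for v using T S D by (auto simp: M_def)
  have DM: "D v = T' * M v * S'" for v
  proof -
    have DS: "D v * S \<in> carrier_mat n m" using D[of v] S by simp
    have "M v = T * (D v * S)" using assoc_mult_mat[OF T(1) D S(1)] by (simp add: M_def)
    then have "T' * M v = D v * S"
      using assoc_mult_mat[OF T(2,1) DS] T(3) left_mult_one_mat[OF DS] by metis
    then show ?thesis using assoc_mult_mat[OF D S(1,2)] S(3) D[of v] by simp
  qed
  have M0: "M v $$ (i, j) = 0" if "a \<le> i" "i < n" "b \<le> j" "j < m" for v i j
  proof -
    note dXv = dX[of v] and dYv = dY[of v]
    have TdX: "T * dX v \<in> carrier_mat n k" and dYS: "dY v * S \<in> carrier_mat k m"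
      and TX': "T * X \<in> carrier_mat n k" and YS': "Y * S \<in> carrier_mat k m"
      using T S X Y dXv dYv by auto
    have prods: "dX v * Y \<in> carrier_mat n m" "X * dY v \<in> carrier_mat n m"
      using X Y dXv dYv by auto
    have "M v = (T * (dX v * Y) + T * (X * dY v)) * S"
      unfolding M_def D_def by (simp only: mult_add_distrib_mat[OF T(1) prods])
    also have "\<dots> = T * (dX v * Y) * S + T * (X * dY v) * S"
      using add_mult_distrib_mat[OF mult_carrier_mat[OF T(1) prods(1)]
          mult_carrier_mat[OF T(1) prods(2)] S(1)] .
    also have "T * (dX v * Y) * S = (T * dX v) * (Y * S)"
      by (simp only: assoc_mult_mat[OF T(1) dXv Y, symmetric] assoc_mult_mat[OF TdX Y S(1)])
    also have "T * (X * dY v) * S = (T * X) * (dY v * S)"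
      by (simp only: assoc_mult_mat[OF T(1) X dYv, symmetric] assoc_mult_mat[OF TX' dYv S(1)])
    finally have "M v $$ (i, j) =
        ((T * dX v) * (Y * S)) $$ (i, j) + ((T * X) * (dY v * S)) $$ (i, j)"
      using T S X Y dXv dYv that by simp
    moreover have "((T * dX v) * (Y * S)) $$ (i, j) = 0"
      using mult_mat_index[OF TdX YS'] YS that by (simp add: Y_def)
    moreover have "((T * X) * (dY v * S)) $$ (i, j) = 0"
      using mult_mat_index[OF TX' dYS] TX that by (simp add: X_def)
    ultimately show ?thesis by simp
  qed
  define I where "I = {..<n} \<times> {..<m} - {a..<n} \<times> {b..<m}"
  have cardI: "card I = n * m - (n - a) * (m - b)"
    unfolding I_def by (subst card_Diff_subset) (auto simp: card_cartesian_product)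
  have "finite I" by (simp add: I_def)
  then obtain e where e: "bij_betw e {..<card I} I"
    using ex_bij_betw_nat_finite by (auto simp: atLeast0LessThan)
  have DI: "D v $$ (i, j) = (\<Sum>q<card I. (T' $$ (i, fst (e q)) * S' $$ (snd (e q), j)) * M v $$ e q)"
    if ij: "i < n" "j < m" for v i j
  proof -
    have TM: "T' * M v \<in> carrier_mat n m" using T M[of v] by simp
    have "D v $$ (i, j) = (\<Sum>t<m. (\<Sum>s<n. T' $$ (i, s) * M v $$ (s, t)) * S' $$ (t, j))"
      unfolding DM mult_mat_index[OF TM S(2) ij]
      by (intro sum.cong refl) (use mult_mat_index[OF T(2) M ij(1)] in auto)
    also have "\<dots> = (\<Sum>s<n. \<Sum>t<m. (T' $$ (i, s) * S' $$ (t, j)) * M v $$ (s, t))"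
      by (subst sum.swap) (simp add: sum_distrib_left sum_distrib_right mult_ac)
    also have "\<dots> = (\<Sum>(s, t)\<in>{..<n} \<times> {..<m}. (T' $$ (i, s) * S' $$ (t, j)) * M v $$ (s, t))"
      by (simp add: sum.cartesian_product)
    also have "\<dots> = (\<Sum>st\<in>I. (T' $$ (i, fst st) * S' $$ (snd st, j)) * M v $$ st)"
      by (intro sum.mono_neutral_cong_right) (auto simp: I_def M0)
    also have "\<dots> = (\<Sum>q<card I. (T' $$ (i, fst (e q)) * S' $$ (snd (e q), j)) * M v $$ e q)"
      by (rule sum.reindex_bij_betw[OF e, symmetric])
    finally show ?thesis .
  qed
  have J: "jacobian n m k p \<in> carrier_mat (n * m) (k * (n + m))" by (simp add: jacobian_def)
  have JD: "jacobian n m k p $$ (r, v) = D v $$ (r div m, r mod m)"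
    if r: "r < n * m" and v: "v < k * (n + m)" for r v
  proof -
    have "m > 0" using r by (cases m) auto
    then have ij: "r div m < n" "r mod m < m" using r by (simp_all add: less_mult_imp_div_less)
    have "D v $$ (r div m, r mod m) =
        (dX v * Y) $$ (r div m, r mod m) + (X * dY v) $$ (r div m, r mod m)"
      using ij X Y dX[of v] dY[of v] by (simp add: D_def)
    also have "\<dots> = (\<Sum>h<k. dX v $$ (r div m, h) * Y $$ (h, r mod m))
        + (\<Sum>h<k. X $$ (r div m, h) * dY v $$ (h, r mod m))"
      using mult_mat_index[OF dX Y ij] mult_mat_index[OF X dY ij] by simp
    also have "\<dots> = jacobian n m k p $$ (r, v)"
      unfolding jacobian_entry[OF r v] sum.distrib using ij
      by (simp add: X_def Y_def dX_def dY_def x_factor_def y_factor_def)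
    finally show ?thesis by simp
  qed
  have "vec_space.rank (n * m) (jacobian n m k p) \<le> card I"
  proof (rule rank_le_of_sum_of_products[OF J])
    fix r v assume r: "r < n * m" and v: "v < k * (n + m)"
    have "m > 0" using r by (cases m) auto
    then have "r div m < n" "r mod m < m" using r by (simp_all add: less_mult_imp_div_less)
    then show "jacobian n m k p $$ (r, v) = (\<Sum>q<card I.
        (T' $$ (r div m, fst (e q)) * S' $$ (snd (e q), r mod m)) * M v $$ e q)"
      using JD[OF r v] DI by simp
  qed
  then show ?thesis using J by (simp add: mat_rank_def cardI)
qed

text \<open>Since \<open>k (n + m - k) = n m - (n - k) (m - k)\<close>, a deficient factor would enlarge the zero block
strictly and make the rank too small. Strictness needs both \<open>k < n\<close> and \<open>k < m\<close>: for \<open>k = n\<close> and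
an invertible left factor, the block is empty and the right factor can have any rank.\<close>

lemma factors_one_sided_invertible:
  assumes kn: "k < n" and km: "k < m"
    and rk: "mat_rank (jacobian n m k p) = k * (n + m - k)"
  shows "\<exists>L \<in> carrier_mat k n. L * x_factor n m k p = 1\<^sub>m k"
    and "\<exists>R \<in> carrier_mat m k. y_factor n m k p * R = 1\<^sub>m k"
proof -
  define X Y where "X = x_factor n m k p" and "Y = y_factor n m k p"
  have X: "X \<in> carrier_mat n k" and Y: "Y \<in> carrier_mat k m" by (simp_all add: X_def Y_def)
  obtain T T' a where T: "T \<in> carrier_mat n n" "T' \<in> carrier_mat n n" "T' * T = 1\<^sub>m n"
    and a: "a \<le> k" and T0: "\<And>i j. a \<le> i \<Longrightarrow> i < n \<Longrightarrow> j < k \<Longrightarrow> (T * X) $$ (i, j) = 0"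
    and TL: "a < k \<or> (\<exists>L \<in> carrier_mat k n. L * X = 1\<^sub>m k)"
    using row_reduction_or_left_inverse[OF X] kn by (metis less_imp_le)
  have Yt: "Y\<^sup>T \<in> carrier_mat m k" using Y by simp
  obtain S S' b where S: "S \<in> carrier_mat m m" "S' \<in> carrier_mat m m" "S' * S = 1\<^sub>m m"
    and b: "b \<le> k" and S0: "\<And>i j. b \<le> i \<Longrightarrow> i < m \<Longrightarrow> j < k \<Longrightarrow> (S * Y\<^sup>T) $$ (i, j) = 0"
    and SR: "b < k \<or> (\<exists>L \<in> carrier_mat k m. L * Y\<^sup>T = 1\<^sub>m k)"
    using row_reduction_or_left_inverse[OF Yt] km by (metis less_imp_le)
  have tr: "Y * S\<^sup>T = (S * Y\<^sup>T)\<^sup>T" using transpose_mult[OF S(1) Yt] by simp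
  have "(Y * S\<^sup>T) $$ (h, j) = 0" if "h < k" "b \<le> j" "j < m" for h j
    unfolding tr using that S(1) Yt S0[of j h] by simp
  moreover have "S\<^sup>T * S'\<^sup>T = 1\<^sub>m m" using transpose_mult[OF S(2,1)] S(3) by simp
  ultimately have "mat_rank (jacobian n m k p) \<le> n * m - (n - a) * (m - b)"
    using rank_jacobian_le[OF T, of "S\<^sup>T" m "S'\<^sup>T" a k p b] S T0 unfolding X_def Y_def by simp
  then have "k * (n + m - k) \<le> n * m - (n - a) * (m - b)" by (simp add: rk)
  moreover have "n * m = k * (n + m - k) + (n - k) * (m - k)"
  proof -
    obtain n' m' where "n = k + n'" "m = k + m'" using kn km by (metis less_imp_add_positive)
    then show ?thesis by (simp add: algebra_simps)
  qed
  moreover have "(n - a) * (m - b) \<le> n * m" by (simp add: mult_le_mono)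
  ultimately have le: "(n - a) * (m - b) \<le> (n - k) * (m - k)" by linarith
  have ab: "a = k" "b = k"
  proof -
    have "\<not> a < k"
    proof
      assume "a < k"
      then have "(n - k) * (m - k) < (n - a) * (m - k)" using kn km by simp
      also have "\<dots> \<le> (n - a) * (m - b)" using b by (intro mult_le_mono) auto
      finally show False using le by simp
    qed
    moreover have "\<not> b < k"
    proof
      assume "b < k"
      then have "(n - k) * (m - k) < (n - k) * (m - b)" using kn km by simp
      also have "\<dots> \<le> (n - a) * (m - b)" using a by (intro mult_le_mono) auto
      finally show False using le by simp
    qed
    ultimately show "a = k" "b = k" using a b by auto
  qed
  show "\<exists>L \<in> carrier_mat k n. L * x_factor n m k p = 1\<^sub>m k" using TL ab by (simp add: X_def)
  obtain L where L: "L \<in> carrier_mat k m" "L * Y\<^sup>T = 1\<^sub>m k" using SR ab by auto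
  have "Y * L\<^sup>T = (L * Y\<^sup>T)\<^sup>T" using transpose_mult[OF L(1) Yt] by simp
  then have "Y * L\<^sup>T = 1\<^sub>m k" using L(2) by simp
  then show "\<exists>R \<in> carrier_mat m k. y_factor n m k p * R = 1\<^sub>m k"
    using L(1) by (intro bexI[of _ "L\<^sup>T"]) (auto simp: Y_def)
qed

section \<open>Positive factorizations of nearby matrices of the same rank\<close>

text \<open>The dimensions belong to the predicate, because entries outside them are arbitrary.\<close>

definition entrywise_limit :: "(nat \<Rightarrow> real mat) \<Rightarrow> real mat \<Rightarrow> nat \<Rightarrow> nat \<Rightarrow> bool" where
  "entrywise_limit F A n m \<longleftrightarrow> A \<in> carrier_mat n m \<and> (\<forall>t. F t \<in> carrier_mat n m) \<and>
     (\<forall>i<n. \<forall>j<m. (\<lambda>t. F t $$ (i, j)) \<longlonglongrightarrow> A $$ (i, j))"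

lemma entrywise_limit_const: "A \<in> carrier_mat n m \<Longrightarrow> entrywise_limit (\<lambda>_. A) A n m"
  by (simp add: entrywise_limit_def)

lemma entrywise_limit_mult:
  assumes "entrywise_limit F A n c" "entrywise_limit G B c m"
  shows "entrywise_limit (\<lambda>t. F t * G t) (A * B) n m"
proof -
  note c = assms[unfolded entrywise_limit_def]
  have "(\<lambda>t. (F t * G t) $$ (i, j)) \<longlonglongrightarrow> (A * B) $$ (i, j)" if ij: "i < n" "j < m" for i j
  proof -
    have 1: "(F t * G t) $$ (i, j) = (\<Sum>h<c. F t $$ (i, h) * G t $$ (h, j))" for t
      using c ij by (intro mult_mat_index) auto
    have 2: "(A * B) $$ (i, j) = (\<Sum>h<c. A $$ (i, h) * B $$ (h, j))"
      using c ij by (intro mult_mat_index) auto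
    show ?thesis unfolding 1 2 using c ij by (intro tendsto_sum tendsto_mult) auto
  qed
  moreover have "F t * G t \<in> carrier_mat n m" for t
    using c mult_carrier_mat by blast
  moreover have "A * B \<in> carrier_mat n m" using c mult_carrier_mat by blast
  ultimately show ?thesis unfolding entrywise_limit_def by blast
qed

lemma entrywise_limit_det:
  assumes "entrywise_limit F A n n"
  shows "(\<lambda>t. det (F t)) \<longlonglongrightarrow> det A"
proof -
  note c = assms[unfolded entrywise_limit_def]
  have 1: "det (F t) = (\<Sum>p\<in>{p. p permutes {0..<n}}. signof p * (\<Prod>i = 0..<n. F t $$ (i, p i)))" for t
    using c by (intro det_def') auto
  have 2: "det A = (\<Sum>p\<in>{p. p permutes {0..<n}}. signof p * (\<Prod>i = 0..<n. A $$ (i, p i)))"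
    using c by (intro det_def') auto
  show ?thesis unfolding 1 2
  proof (intro tendsto_sum tendsto_mult tendsto_const tendsto_prod)
    fix p i assume "p \<in> {p. p permutes {0..<n}}" "i \<in> {0..<n}"
    then have "i < n" "p i < n" using permutes_in_image[of p "{0..<n}" i] by auto
    then show "(\<lambda>t. F t $$ (i, p i)) \<longlonglongrightarrow> A $$ (i, p i)" using c by blast
  qed
qed

text \<open>The adjugate gives continuity of the inverse, being polynomial in the entries and defined
even when the matrix is singular.\<close>

lemma entrywise_limit_adj_mat:
  assumes "entrywise_limit F A n n"
  shows "entrywise_limit (\<lambda>t. adj_mat (F t)) (adj_mat A) n n"
proof -
  note c = assms[unfolded entrywise_limit_def]
  have "(\<lambda>t. adj_mat (F t) $$ (i, j)) \<longlonglongrightarrow> adj_mat A $$ (i, j)" if ij: "i < n" "j < n" for i j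
  proof -
    have "entrywise_limit (\<lambda>t. mat_delete (F t) j i) (mat_delete A j i) (n - 1) (n - 1)"
      unfolding entrywise_limit_def
    proof (intro conjI allI impI mat_delete_carrier)
      fix i' j' assume i'j': "i' < n - 1" "j' < n - 1"
      have d: "mat_delete B j i $$ (i', j') =
          B $$ (if i' < j then i' else Suc i', if j' < i then j' else Suc j')"
        if "B \<in> carrier_mat n n" for B :: "real mat"
        using that i'j' by (auto simp: mat_delete_def)
      show "(\<lambda>t. mat_delete (F t) j i $$ (i', j')) \<longlonglongrightarrow> mat_delete A j i $$ (i', j')"
        using c i'j' by (subst (1 2) d) auto
    qed (use c in auto)
    from entrywise_limit_det[OF this]
    have "(\<lambda>t. cofactor (F t) j i) \<longlonglongrightarrow> cofactor A j i"
      unfolding cofactor_def by (intro tendsto_mult tendsto_const)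
    moreover have "adj_mat B $$ (i, j) = cofactor B j i" if "B \<in> carrier_mat n n" for B :: "real mat"
      using that ij by (auto simp: adj_mat_def)
    ultimately show ?thesis using c by simp
  qed
  then show ?thesis using c adj_mat(1) by (auto simp: entrywise_limit_def)
qed

lemma entrywise_limit_eventually_pos:
  assumes "entrywise_limit F A n m" "\<forall>i<n. \<forall>j<m. A $$ (i, j) > 0"
  shows "\<forall>\<^sub>F t in sequentially. \<forall>i<n. \<forall>j<m. F t $$ (i, j) > 0"
proof -
  have "\<forall>\<^sub>F t in sequentially. \<forall>i\<in>{..<n}. \<forall>j\<in>{..<m}. F t $$ (i, j) > 0"
  proof (intro eventually_ball_finite ballI finite_lessThan)
    fix i j assume "i \<in> {..<n}" "j \<in> {..<m}"
    then show "\<forall>\<^sub>F t in sequentially. F t $$ (i, j) > 0"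
      using assms order_tendstoD(1)[of "\<lambda>t. F t $$ (i, j)" "A $$ (i, j)" sequentially 0]
      by (auto simp: entrywise_limit_def)
  qed
  then show ?thesis by (rule eventually_mono) auto
qed

text \<open>Write \<open>A = B * C\<close> with inner dimension \<open>k\<close>. Then \<open>L * A * R = (L * B) * (C * R)\<close> is a product of
square matrices, so both are invertible, and in \<open>A * R * W * L * A\<close> the middle part
\<open>(C * R) * W * (L * B)\<close> cancels.\<close>

lemma factorization_from_projections:
  fixes A :: "real mat"
  assumes A: "A \<in> carrier_mat n m" and rk: "vec_space.rank n A \<le> k"
    and L: "L \<in> carrier_mat k n" and R: "R \<in> carrier_mat m k" and W: "W \<in> carrier_mat k k"
    and inv: "(L * A * R) * W = 1\<^sub>m k"
  shows "A = (A * R * W) * (L * A)"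
proof -
  obtain B C where B: "B \<in> carrier_mat n k" and C: "C \<in> carrier_mat k m" and BC: "A = B * C"
    using rank_factorization[OF A rk] by blast
  define G H where "G = L * B" and "H = C * R"
  have G: "G \<in> carrier_mat k k" and H: "H \<in> carrier_mat k k"
    using L R B C by (auto simp: G_def H_def)
  have LA: "L * A = G * C" using assoc_mult_mat[OF L B C] by (simp add: BC G_def)
  have AR: "A * R = B * H" using assoc_mult_mat[OF B C R] by (simp add: BC H_def)
  have LAR: "L * A * R = G * H" using assoc_mult_mat[OF G C R] by (simp add: LA H_def)
  have "G * (H * W) = 1\<^sub>m k" using inv assoc_mult_mat[OF G H W] by (simp add: LAR)
  then have HWG: "(H * W) * G = 1\<^sub>m k"
    using mat_mult_left_right_inverse[OF G, of "H * W"] H W by simp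
  have HW: "H * W \<in> carrier_mat k k" using H W by simp
  have "(A * R * W) * (L * A) = (B * (H * W)) * (G * C)"
    using assoc_mult_mat[OF B H W] by (simp add: AR LA)
  also have "\<dots> = B * ((H * W) * (G * C))"
    using assoc_mult_mat[OF B HW, of "G * C" m] G C by simp
  also have "(H * W) * (G * C) = C"
    using assoc_mult_mat[OF HW G C] HWG C by simp
  finally show ?thesis by (simp add: BC)
qed

text \<open>The factors \<open>N t * R * inverse (L * N t * R)\<close> and \<open>L * N t\<close> converge to \<open>X\<close> and \<open>Y\<close>.\<close>

lemma eventually_positive_factorization:
  assumes lim: "entrywise_limit N (X * Y) n m"
    and X: "X \<in> carrier_mat n k" and Y: "Y \<in> carrier_mat k m"
    and posX: "\<forall>i<n. \<forall>h<k. X $$ (i, h) > 0"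
    and posY: "\<forall>h<k. \<forall>j<m. Y $$ (h, j) > 0"
    and L: "L \<in> carrier_mat k n" and LX: "L * X = 1\<^sub>m k"
    and R: "R \<in> carrier_mat m k" and YR: "Y * R = 1\<^sub>m k"
    and rk: "\<And>t. vec_space.rank n (N t) \<le> k"
  shows "\<forall>\<^sub>F t in sequentially. \<exists>X' \<in> carrier_mat n k. \<exists>Y' \<in> carrier_mat k m.
    N t = X' * Y' \<and> (\<forall>i<n. \<forall>h<k. X' $$ (i, h) > 0) \<and> (\<forall>h<k. \<forall>j<m. Y' $$ (h, j) > 0)"
proof -
  note Lc = entrywise_limit_const[OF L] and Rc = entrywise_limit_const[OF R]
  have N: "N t \<in> carrier_mat n m" for t using lim by (simp add: entrywise_limit_def)
  have "L * (X * Y) = Y" using assoc_mult_mat[OF L X Y] LX Y by simp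
  then have limY: "entrywise_limit (\<lambda>t. L * N t) Y k m"
    using entrywise_limit_mult[OF Lc lim] by simp
  have "(X * Y) * R = X" using assoc_mult_mat[OF X Y R] YR X by simp
  then have limX: "entrywise_limit (\<lambda>t. N t * R) X n k"
    using entrywise_limit_mult[OF lim Rc] by simp
  define K where "K t = L * N t * R" for t
  have limK: "entrywise_limit K (1\<^sub>m k) k k"
    using entrywise_limit_mult[OF limY Rc] YR by (simp add: K_def[abs_def])
  have K: "K t \<in> carrier_mat k k" for t
    using mult_carrier_mat[OF mult_carrier_mat[OF L N] R] by (simp add: K_def)
  have limdet: "(\<lambda>t. det (K t)) \<longlonglongrightarrow> 1" using entrywise_limit_det[OF limK] by simp
  have "adj_mat (1\<^sub>m k :: real mat) = 1\<^sub>m k"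
    using adj_mat(1,2)[of "1\<^sub>m k :: real mat" k] by (auto intro!: eq_matI)
  then have "entrywise_limit (\<lambda>t. (N t * R) * adj_mat (K t)) X n k"
    using entrywise_limit_mult[OF limX entrywise_limit_adj_mat[OF limK]] X by simp
  from entrywise_limit_eventually_pos[OF this posX]
  have evX: "\<forall>\<^sub>F t in sequentially. \<forall>i<n. \<forall>h<k. ((N t * R) * adj_mat (K t)) $$ (i, h) > 0" .
  from entrywise_limit_eventually_pos[OF limY posY]
  have evY: "\<forall>\<^sub>F t in sequentially. \<forall>h<k. \<forall>j<m. (L * N t) $$ (h, j) > 0" .
  have "\<forall>\<^sub>F t in sequentially. det (K t) > 0"
    by (rule order_tendstoD(1)[OF limdet]) simp
  with evX evY show ?thesis
  proof eventually_elim
    case (elim t)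
    \<comment> \<open>Cramer's rule; the determinant tends to \<open>1\<close>, so it does not affect signs.\<close>
    define W where "W = inverse (det (K t)) \<cdot>\<^sub>m adj_mat (K t)"
    have adj: "adj_mat (K t) \<in> carrier_mat k k" using adj_mat(1)[OF K] .
    have W: "W \<in> carrier_mat k k" using adj by (simp add: W_def)
    have "K t * W = inverse (det (K t)) \<cdot>\<^sub>m (K t * adj_mat (K t))"
      unfolding W_def using mult_smult_distrib[OF K adj] by simp
    also have "\<dots> = 1\<^sub>m k"
      unfolding adj_mat(2)[OF K] using elim(3) by (intro eq_matI) auto
    finally have "N t = (N t * R * W) * (L * N t)"
      using factorization_from_projections[OF N rk L R W] by (simp add: K_def)
    moreover have NR: "N t * R \<in> carrier_mat n k" using N[of t] R by simp
    then have "N t * R * W = inverse (det (K t)) \<cdot>\<^sub>m ((N t * R) * adj_mat (K t))"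
      unfolding W_def using mult_smult_distrib[OF _ adj] by simp
    then have "(N t * R * W) $$ (i, h) = inverse (det (K t)) * ((N t * R) * adj_mat (K t)) $$ (i, h)"
      if "i < n" "h < k" for i h
      using that N[of t] R adj by (simp del: index_mult_mat(1))
    then have "\<forall>i<n. \<forall>h<k. (N t * R * W) $$ (i, h) > 0"
      using elim(1,3) by simp
    moreover have "L * N t \<in> carrier_mat k m" using L N[of t] by simp
    moreover have "N t * R * W \<in> carrier_mat n k" using NR W by simp
    ultimately show ?case using elim(2) by blast
  qed
qed

section \<open>Lower semicontinuity of the non-negative rank\<close>

text \<open>The factors are families of functions, so that bounds and limits apply entry by entry.\<close>

definition nonneg_factorable :: "real mat \<Rightarrow> nat \<Rightarrow> bool" where
  "nonneg_factorable A d \<longleftrightarrow> (\<exists>C R :: nat \<Rightarrow> nat \<Rightarrow> real.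
     (\<forall>h<d. \<forall>i<dim_row A. C h i \<ge> 0) \<and> (\<forall>h<d. \<forall>j<dim_col A. R h j \<ge> 0) \<and>
     (\<forall>i<dim_row A. \<forall>j<dim_col A. A $$ (i, j) = (\<Sum>h<d. C h i * R h j)))"

lemma nonneg_rank_eq_Least: "nonneg_rank A = (LEAST d. nonneg_factorable A d)"
proof -
  have "nonneg_factorable A d \<longleftrightarrow> (\<exists>c r.
     (\<forall>h < d. c h \<in> carrier_vec (dim_row A) \<and> nonneg_vec (c h) \<and>
              r h \<in> carrier_vec (dim_col A) \<and> nonneg_vec (r h)) \<and>
     A = mat (dim_row A) (dim_col A) (\<lambda>(i, j). \<Sum>h<d. c h $ i * r h $ j))"
    (is "_ \<longleftrightarrow> ?vecs") for d
  proof
    assume "nonneg_factorable A d"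
    then obtain C R where CR: "\<forall>h<d. \<forall>i<dim_row A. C h i \<ge> 0" "\<forall>h<d. \<forall>j<dim_col A. R h j \<ge> 0"
      "\<forall>i<dim_row A. \<forall>j<dim_col A. A $$ (i, j) = (\<Sum>h<d. C h i * R h j)"
      unfolding nonneg_factorable_def by blast
    show ?vecs
      by (rule exI[of _ "\<lambda>h. vec (dim_row A) (C h)"], rule exI[of _ "\<lambda>h. vec (dim_col A) (R h)"])
        (use CR in \<open>auto simp: nonneg_vec_def intro!: eq_matI\<close>)
  next
    assume ?vecs
    then obtain c r where cr: "\<forall>h < d. c h \<in> carrier_vec (dim_row A) \<and> nonneg_vec (c h) \<and>
              r h \<in> carrier_vec (dim_col A) \<and> nonneg_vec (r h)"
      and A: "A = mat (dim_row A) (dim_col A) (\<lambda>(i, j). \<Sum>h<d. c h $ i * r h $ j)" by blast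
    have "A $$ (i, j) = (\<Sum>h<d. c h $ i * r h $ j)" if "i < dim_row A" "j < dim_col A" for i j
      by (subst A) (use that in simp)
    then show "nonneg_factorable A d"
      unfolding nonneg_factorable_def
      by (intro exI[of _ "\<lambda>h i. c h $ i"] exI[of _ "\<lambda>h j. r h $ j"])
        (use cr in \<open>auto simp: nonneg_vec_def\<close>)
  qed
  then show ?thesis by (simp add: nonneg_rank_def)
qed

lemma nonneg_factorable_mono:
  assumes "nonneg_factorable A d" "d \<le> d'"
  shows "nonneg_factorable A d'"
proof -
  obtain C R where CR: "\<forall>h<d. \<forall>i<dim_row A. C h i \<ge> 0" "\<forall>h<d. \<forall>j<dim_col A. R h j \<ge> 0"
    "\<forall>i<dim_row A. \<forall>j<dim_col A. A $$ (i, j) = (\<Sum>h<d. C h i * R h j)"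
    using assms(1) unfolding nonneg_factorable_def by blast
  have "(\<Sum>h<d. C h i * R h j) = (\<Sum>h<d'. (if h < d then C h i else 0) * R h j)" for i j
    using assms(2) by (intro sum.mono_neutral_cong_left) auto
  then show ?thesis
    using CR unfolding nonneg_factorable_def
    by (intro exI[of _ "\<lambda>h i. if h < d then C h i else 0"]
        exI[of _ "\<lambda>h j. if h < d then R h j else 0"]) (auto intro!: sum.cong)
qed

lemma nonneg_factorable_mult:
  assumes "X \<in> carrier_mat n d" "Y \<in> carrier_mat d m"
    and "\<And>i h. i < n \<Longrightarrow> h < d \<Longrightarrow> X $$ (i, h) \<ge> 0"
    and "\<And>h j. h < d \<Longrightarrow> j < m \<Longrightarrow> Y $$ (h, j) \<ge> 0"
  shows "nonneg_factorable (X * Y) d"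
  unfolding nonneg_factorable_def
  by (rule exI[of _ "\<lambda>h i. X $$ (i, h)"], rule exI[of _ "\<lambda>h j. Y $$ (h, j)"])
    (use assms mult_mat_index[OF assms(1,2)] in auto)

lemma nonneg_factorable_dims:
  assumes A: "A \<in> carrier_mat n m" and "nonneg_mat A"
  shows "nonneg_factorable A n" "nonneg_factorable A m"
proof -
  have nn: "\<And>i j. i < n \<Longrightarrow> j < m \<Longrightarrow> A $$ (i, j) \<ge> 0"
    using assms by (auto simp: nonneg_mat_def)
  show "nonneg_factorable A n"
    using nonneg_factorable_mult[OF one_carrier_mat A] nn A by simp
  show "nonneg_factorable A m"
    using nonneg_factorable_mult[OF A one_carrier_mat] nn A by simp
qed

lemma nonneg_rank_le_iff:
  assumes "nonneg_mat A"
  shows "nonneg_rank A \<le> d \<longleftrightarrow> nonneg_factorable A d"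
proof
  have "nonneg_factorable A (nonneg_rank A)"
    unfolding nonneg_rank_eq_Least
    using nonneg_factorable_dims(1)[OF _ assms, of "dim_row A" "dim_col A"]
    by (intro LeastI[of "nonneg_factorable A"]) auto
  then show "nonneg_rank A \<le> d \<Longrightarrow> nonneg_factorable A d" by (rule nonneg_factorable_mono)
next
  show "nonneg_factorable A d \<Longrightarrow> nonneg_rank A \<le> d"
    unfolding nonneg_rank_eq_Least by (rule Least_le)
qed

text \<open>Only the products of the entries of the \<open>h\<close>-th column and the \<open>h\<close>-th row matter, so the row can be
normalized to sum \<open>1\<close> by moving the factor \<open>s h\<close> to the column. By non-negativity no cancellation
occurs, and the new column entry is at most the corresponding row sum of \<open>A\<close>. A zero row has
\<open>s h = 0\<close>; the rescaled column and row are then both zero, since division by zero gives zero.\<close>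

lemma nonneg_factorable_bounded:
  assumes "nonneg_factorable A d"
  obtains C R :: "nat \<Rightarrow> nat \<Rightarrow> real"
  where "\<And>h i. h < d \<Longrightarrow> i < dim_row A \<Longrightarrow> 0 \<le> C h i \<and> C h i \<le> (\<Sum>j<dim_col A. A $$ (i, j))"
    and "\<And>h j. h < d \<Longrightarrow> j < dim_col A \<Longrightarrow> 0 \<le> R h j \<and> R h j \<le> 1"
    and "\<And>i j. i < dim_row A \<Longrightarrow> j < dim_col A \<Longrightarrow> A $$ (i, j) = (\<Sum>h<d. C h i * R h j)"
proof -
  obtain C R where C: "\<And>h i. h < d \<Longrightarrow> i < dim_row A \<Longrightarrow> C h i \<ge> 0"
    and R: "\<And>h j. h < d \<Longrightarrow> j < dim_col A \<Longrightarrow> R h j \<ge> 0"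
    and A: "\<And>i j. i < dim_row A \<Longrightarrow> j < dim_col A \<Longrightarrow> A $$ (i, j) = (\<Sum>h<d. C h i * R h j)"
    using assms unfolding nonneg_factorable_def by blast
  define s where "s h = (\<Sum>j<dim_col A. R h j)" for h
  have s: "0 \<le> s h" if "h < d" for h using R that by (auto simp: s_def intro: sum_nonneg)
  have Rs: "R h j \<le> s h" if "h < d" "j < dim_col A" for h j
    unfolding s_def using that R by (intro member_le_sum) auto
  have prod: "(C h i * s h) * (R h j / s h) = C h i * R h j" if "h < d" "j < dim_col A" for h i j
    using Rs[OF that] R[OF that] by (cases "s h = 0") auto
  show ?thesis
  proof (rule that[of "\<lambda>h i. C h i * s h" "\<lambda>h j. R h j / s h"])
    fix h i assume hi: "h < d" "i < dim_row A"
    have "C h i * s h = (\<Sum>j<dim_col A. C h i * R h j)" by (simp add: s_def sum_distrib_left)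
    also have "\<dots> \<le> (\<Sum>j<dim_col A. A $$ (i, j))"
    proof (rule sum_mono)
      fix j assume "j \<in> {..<dim_col A}"
      then have j: "j < dim_col A" by simp
      show "C h i * R h j \<le> A $$ (i, j)"
        unfolding A[OF hi(2) j]
        by (rule member_le_sum[of h "{..<d}" "\<lambda>h. C h i * R h j"]) (use hi j C R in auto)
    qed
    finally show "0 \<le> C h i * s h \<and> C h i * s h \<le> (\<Sum>j<dim_col A. A $$ (i, j))"
      using C[OF hi] s[OF hi(1)] by simp
  next
    fix h j assume hj: "h < d" "j < dim_col A"
    show "0 \<le> R h j / s h \<and> R h j / s h \<le> 1"
      using R[OF hj] Rs[OF hj] s[OF hj(1)] by (cases "s h = 0") (auto simp: divide_le_eq)
  next
    fix i j assume ij: "i < dim_row A" "j < dim_col A"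
    show "A $$ (i, j) = (\<Sum>h<d. (C h i * s h) * (R h j / s h))"
      unfolding A[OF ij] by (rule sum.cong[OF refl], rule prod[symmetric]) (use ij in auto)
  qed
qed

lemma common_convergent_subsequence:
  fixes x :: "'a \<Rightarrow> nat \<Rightarrow> real"
  assumes "finite I" "\<And>i. i \<in> I \<Longrightarrow> Bseq (x i)"
  obtains \<sigma> :: "nat \<Rightarrow> nat" where "strict_mono \<sigma>" "\<And>i. i \<in> I \<Longrightarrow> convergent (x i \<circ> \<sigma>)"
proof -
  have "\<exists>\<sigma> :: nat \<Rightarrow> nat. strict_mono \<sigma> \<and> (\<forall>i\<in>I. convergent (x i \<circ> \<sigma>))"
    using assms
  proof (induction I)
    case empty
    show ?case by (intro exI[of _ id]) (auto simp: strict_mono_def)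
  next
    case (insert a I)
    then have "\<exists>\<sigma> :: nat \<Rightarrow> nat. strict_mono \<sigma> \<and> (\<forall>i\<in>I. convergent (x i \<circ> \<sigma>))"
      by blast
    then obtain \<sigma> :: "nat \<Rightarrow> nat" where \<sigma>: "strict_mono \<sigma>" "\<forall>i\<in>I. convergent (x i \<circ> \<sigma>)"
      by blast
    have "Bseq (x a \<circ> \<sigma>)"
      using insert.prems[of a] Bseq_subseq[of "x a" \<sigma>] by (simp add: o_def)
    then obtain l \<tau> where \<tau>: "strict_mono \<tau>" "((x a \<circ> \<sigma>) \<circ> \<tau>) \<longlonglongrightarrow> l"
      using bounded_imp_convergent_subsequence[of "x a \<circ> \<sigma>"] by (auto simp: Bseq_eq_bounded)
    have "convergent (x i \<circ> (\<sigma> \<circ> \<tau>))" if "i \<in> insert a I" for i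
    proof (cases "i = a")
      case True
      then show ?thesis using \<tau>(2) by (auto simp: convergent_def o_assoc)
    next
      case False
      then show ?thesis
        using \<sigma>(2) that convergent_subseq_convergent[OF _ \<tau>(1), of "x i \<circ> \<sigma>"]
        by (simp add: o_assoc)
    qed
    then show ?case using strict_mono_o[OF \<sigma>(1) \<tau>(1)] by blast
  qed
  then show ?thesis using that by blast
qed

text \<open>By \<open>nonneg_factorable_bounded\<close> the factorizations of a convergent sequence stay bounded, because
the row sums converge; a common convergent subsequence of all their entries yields a factorization
of the limit.\<close>

lemma nonneg_factorable_closed:
  assumes lim: "entrywise_limit N A n m" and fac: "\<And>t. nonneg_factorable (N t) d"
  shows "nonneg_factorable A d"
proof -
  have A: "A \<in> carrier_mat n m" and N: "\<And>t. N t \<in> carrier_mat n m"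
    and conv: "\<And>i j. i < n \<Longrightarrow> j < m \<Longrightarrow> (\<lambda>t. N t $$ (i, j)) \<longlonglongrightarrow> A $$ (i, j)"
    using lim by (auto simp: entrywise_limit_def)
  have dims: "dim_row (N t) = n" "dim_col (N t) = m" for t using N[of t] by auto
  define bounded_fac where "bounded_fac t = (\<lambda>(C, R).
      (\<forall>h<d. \<forall>i<n. 0 \<le> C h i \<and> C h i \<le> (\<Sum>j<m. N t $$ (i, j))) \<and>
      (\<forall>h<d. \<forall>j<m. 0 \<le> R h j \<and> R h j \<le> (1::real)) \<and>
      (\<forall>i<n. \<forall>j<m. N t $$ (i, j) = (\<Sum>h<d. C h i * R h j)))" for t
  have "\<exists>CR. bounded_fac t CR" for t
  proof (rule nonneg_factorable_bounded[OF fac[of t], unfolded dims])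
    fix C R :: "nat \<Rightarrow> nat \<Rightarrow> real"
    assume "\<And>h i. h < d \<Longrightarrow> i < n \<Longrightarrow> 0 \<le> C h i \<and> C h i \<le> (\<Sum>j<m. N t $$ (i, j))"
      "\<And>h j. h < d \<Longrightarrow> j < m \<Longrightarrow> 0 \<le> R h j \<and> R h j \<le> 1"
      "\<And>i j. i < n \<Longrightarrow> j < m \<Longrightarrow> N t $$ (i, j) = (\<Sum>h<d. C h i * R h j)"
    then have "bounded_fac t (C, R)" unfolding bounded_fac_def by blast
    then show ?thesis by blast
  qed
  then obtain CR where CR: "\<And>t. bounded_fac t (CR t)" by metis
  define C R where "C t = fst (CR t)" and "R t = snd (CR t)" for t
  have C: "0 \<le> C t h i \<and> C t h i \<le> (\<Sum>j<m. N t $$ (i, j))" if "h < d" "i < n" for t h i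
    using CR[of t] that unfolding bounded_fac_def C_def by (auto simp: split_beta)
  have R: "0 \<le> R t h j \<and> R t h j \<le> 1" if "h < d" "j < m" for t h j
    using CR[of t] that unfolding bounded_fac_def R_def by (auto simp: split_beta)
  have NCR: "N t $$ (i, j) = (\<Sum>h<d. C t h i * R t h j)" if "i < n" "j < m" for t i j
    using CR[of t] that unfolding bounded_fac_def C_def R_def by (auto simp: split_beta)
  \<comment> \<open>All entries of both factors, as one finite family of real sequences.\<close>
  define I where "I = ({..<d} \<times> {..<n}) <+> ({..<d} \<times> {..<m})"
  define x where "x = case_sum (\<lambda>(h, i) t. C t h i) (\<lambda>(h, j) t. R t h j)"
  have "Bseq (x q)" if "q \<in> I" for q
  proof (cases q)
    case (Inl hi)
    obtain h i where "hi = (h, i)" by (cases hi)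
    then have hi: "q = Inl (h, i)" "h < d" "i < n" using Inl that by (auto simp: I_def)
    have "convergent (\<lambda>t. \<Sum>j<m. N t $$ (i, j))"
      using tendsto_sum[of "{..<m}" "\<lambda>j t. N t $$ (i, j)" "\<lambda>j. A $$ (i, j)"] conv[OF hi(3)]
      by (auto simp: convergent_def)
    from BseqE[OF convergent_imp_Bseq[OF this]]
    obtain K where K: "\<forall>t. norm (\<Sum>j<m. N t $$ (i, j)) \<le> K" by blast
    have "norm (x q t) \<le> K" for t
      using C[OF hi(2,3), of t] K[rule_format, of t] by (simp add: x_def hi(1))
    then show ?thesis by (rule BseqI')
  next
    case (Inr hj)
    obtain h j where "hj = (h, j)" by (cases hj)
    then have hj: "q = Inr (h, j)" "h < d" "j < m" using Inr that by (auto simp: I_def)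
    have "norm (x q t) \<le> 1" for t
      using R[OF hj(2,3), of t] by (simp add: x_def hj(1))
    then show ?thesis by (rule BseqI')
  qed
  moreover have "finite I" by (simp add: I_def)
  ultimately obtain \<sigma> where \<sigma>: "strict_mono \<sigma>" "\<And>q. q \<in> I \<Longrightarrow> convergent (x q \<circ> \<sigma>)"
    using common_convergent_subsequence[of I x] by blast
  define C' where "C' h i = lim (\<lambda>t. C (\<sigma> t) h i)" for h i
  define R' where "R' h j = lim (\<lambda>t. R (\<sigma> t) h j)" for h j
  have C': "(\<lambda>t. C (\<sigma> t) h i) \<longlonglongrightarrow> C' h i" if "h < d" "i < n" for h i
    using \<sigma>(2)[of "Inl (h, i)"] that
    by (auto simp: I_def x_def o_def C'_def convergent_LIMSEQ_iff)
  have R': "(\<lambda>t. R (\<sigma> t) h j) \<longlonglongrightarrow> R' h j" if "h < d" "j < m" for h j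
    using \<sigma>(2)[of "Inr (h, j)"] that
    by (auto simp: I_def x_def o_def R'_def convergent_LIMSEQ_iff)
  have "C' h i \<ge> 0" if "h < d" "i < n" for h i
    using LIMSEQ_le_const[OF C'[OF that]] C[OF that] by blast
  moreover have "R' h j \<ge> 0" if "h < d" "j < m" for h j
    using LIMSEQ_le_const[OF R'[OF that]] R[OF that] by blast
  moreover have "A $$ (i, j) = (\<Sum>h<d. C' h i * R' h j)" if ij: "i < n" "j < m" for i j
  proof (rule LIMSEQ_unique)
    show "(\<lambda>t. N (\<sigma> t) $$ (i, j)) \<longlonglongrightarrow> A $$ (i, j)"
      using LIMSEQ_subseq_LIMSEQ[OF conv[OF ij] \<sigma>(1)] by (simp add: o_def)
    show "(\<lambda>t. N (\<sigma> t) $$ (i, j)) \<longlonglongrightarrow> (\<Sum>h<d. C' h i * R' h j)"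
      unfolding NCR[OF ij] using C' R' ij by (intro tendsto_sum tendsto_mult) auto
  qed
  ultimately show ?thesis
    unfolding nonneg_factorable_def using A by (intro exI[of _ C'] exI[of _ R']) auto
qed

text \<open>Otherwise infinitely many \<open>N t\<close> would factor through \<open>nonneg_rank A - 1\<close>, and so would their limit
\<open>A\<close>.\<close>

lemma nonneg_rank_lower_semicontinuous:
  assumes lim: "entrywise_limit N A n m"
    and nn: "\<And>t. nonneg_mat (N t)" "nonneg_mat A"
  shows "\<forall>\<^sub>F t in sequentially. nonneg_rank A \<le> nonneg_rank (N t)"
proof (rule ccontr)
  assume "\<not> ?thesis"
  then have inf: "\<exists>\<^sub>F t in sequentially. nonneg_rank (N t) < nonneg_rank A"
    by (simp add: frequently_def not_less)
  define S where "S = {t. nonneg_rank (N t) < nonneg_rank A}"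
  have "infinite S"
    using inf by (simp add: S_def frequently_cofinite[symmetric] cofinite_eq_sequentially)
  then have mono: "strict_mono (enumerate S)" and mem: "\<And>t. enumerate S t \<in> S"
    by (auto simp: strict_mono_enumerate enumerate_in_set)
  define d where "d = nonneg_rank A - 1"
  have less: "nonneg_rank (N (enumerate S t)) < nonneg_rank A" for t
    using mem[of t] by (simp add: S_def)
  have "entrywise_limit (\<lambda>t. N (enumerate S t)) A n m"
    using lim LIMSEQ_subseq_LIMSEQ[OF _ mono] unfolding entrywise_limit_def o_def by blast
  moreover have "nonneg_factorable (N (enumerate S t)) d" for t
    using less[of t] nn(1) by (subst nonneg_rank_le_iff[symmetric]) (auto simp: d_def)
  ultimately have "nonneg_factorable A d" by (rule nonneg_factorable_closed)
  then have "nonneg_rank A \<le> d" using nonneg_rank_le_iff[OF nn(2)] by blast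
  then show False using less[of 0] by (simp add: d_def)
qed

section \<open>Stability of the non-negative rank\<close>

lemma nonneg_ball_entry:
  assumes N: "N \<in> nonneg_ball A e" and i: "i < dim_row A" and j: "j < dim_col A"
  shows "\<bar>N $$ (i, j) - A $$ (i, j)\<bar> < e"
proof -
  have "(A $$ (i, j) - N $$ (i, j))\<^sup>2 \<le> (\<Sum>j<dim_col A. (A $$ (i, j) - N $$ (i, j))\<^sup>2)"
    using j by (intro member_le_sum) auto
  also have "\<dots> \<le> (\<Sum>i<dim_row A. \<Sum>j<dim_col A. (A $$ (i, j) - N $$ (i, j))\<^sup>2)"
    using i by (intro member_le_sum[of i _ "\<lambda>i. \<Sum>j<dim_col A. (A $$ (i, j) - N $$ (i, j))\<^sup>2"])
      (auto intro: sum_nonneg)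
  finally have "sqrt ((A $$ (i, j) - N $$ (i, j))\<^sup>2)
      \<le> sqrt (\<Sum>i<dim_row A. \<Sum>j<dim_col A. (A $$ (i, j) - N $$ (i, j))\<^sup>2)"
    by (rule real_sqrt_le_mono)
  also have "\<dots> < e" using N by (simp add: nonneg_ball_def)
  finally have "sqrt ((A $$ (i, j) - N $$ (i, j))\<^sup>2) < e" .
  then show ?thesis by (simp add: abs_minus_commute)
qed

theorem proposition4p1:
  fixes n m k :: nat and P :: "real mat" and p :: "real vec"
  assumes "k \<le> min n m"
    and "P \<in> carrier_mat n m"
    and "nonneg_mat P"
    and "nonneg_rank P = k"
    and "p \<in> carrier_vec (k * (n + m))"
    and "\<forall>v < k * (n + m). p $ v > 0"
    and "P = factor_map n m k p"
    and "mat_rank (jacobian n m k p) = k * (n + m - k)"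
  shows "\<exists>\<epsilon>>0. \<forall>N \<in> nonneg_ball P \<epsilon>.
           mat_rank N = mat_rank P \<longrightarrow> nonneg_rank N = nonneg_rank P"
proof (rule ccontr)
  assume "\<not> ?thesis"
  then have "\<exists>N \<in> nonneg_ball P e. mat_rank N = mat_rank P \<and> nonneg_rank N \<noteq> nonneg_rank P"
    if "e > 0" for e using that by blast
  then have "\<forall>t :: nat. \<exists>N \<in> nonneg_ball P (1 / Suc t).
      mat_rank N = mat_rank P \<and> nonneg_rank N \<noteq> nonneg_rank P" by simp
  then obtain N where ball: "\<And>t. N t \<in> nonneg_ball P (1 / Suc t)"
    and rank_eq: "\<And>t. mat_rank (N t) = mat_rank P"
    and ne: "\<And>t. nonneg_rank (N t) \<noteq> nonneg_rank P"
    by metis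
  have P: "P \<in> carrier_mat n m" by fact
  have N: "N t \<in> carrier_mat n m" and nnN: "nonneg_mat (N t)" for t
    using ball[of t] P by (auto simp: nonneg_ball_def)
  have lim: "entrywise_limit N P n m"
    unfolding entrywise_limit_def
  proof (intro conjI allI impI P N)
    fix i j assume ij: "i < n" "j < m"
    have "(\<lambda>t. 1 / real (Suc t)) \<longlonglongrightarrow> 0"
      using LIMSEQ_inverse_real_of_nat by (simp add: inverse_eq_divide)
    then have "(\<lambda>t. N t $$ (i, j) - P $$ (i, j)) \<longlonglongrightarrow> 0"
      by (rule Lim_null_comparison[rotated])
        (use nonneg_ball_entry[OF ball] ij P in \<open>auto intro!: always_eventually less_imp_le\<close>)
    then show "(\<lambda>t. N t $$ (i, j)) \<longlonglongrightarrow> P $$ (i, j)" by (rule LIM_zero_cancel)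
  qed
  have lower: "\<forall>\<^sub>F t in sequentially. nonneg_rank P \<le> nonneg_rank (N t)"
    by (rule nonneg_rank_lower_semicontinuous[OF lim nnN]) fact
  have upper: "\<forall>\<^sub>F t in sequentially. nonneg_factorable (N t) k"
  proof (cases "k = n \<or> k = m")
    case True
    then show ?thesis using nonneg_factorable_dims[OF N nnN] by auto
  next
    case False
    then have kn: "k < n" and km: "k < m" using assms(1) by auto
    define X Y where "X = x_factor n m k p" and "Y = y_factor n m k p"
    have X: "X \<in> carrier_mat n k" and Y: "Y \<in> carrier_mat k m" by (simp_all add: X_def Y_def)
    have PXY: "P = X * Y" using assms(7) by (simp add: factor_map_eq_mult X_def Y_def)
    have posX: "\<forall>i<n. \<forall>h<k. X $$ (i, h) > 0"
      using assms(6) by (simp add: X_def x_factor_def x_coord_def factor_coord_less)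
    have posY: "\<forall>h<k. \<forall>j<m. Y $$ (h, j) > 0"
      using assms(6) by (simp add: Y_def y_factor_def y_coord_def factor_coord_less)
    obtain L where L: "L \<in> carrier_mat k n" "L * X = 1\<^sub>m k"
      using factors_one_sided_invertible(1)[OF kn km assms(8)] by (auto simp: X_def)
    obtain R where R: "R \<in> carrier_mat m k" "Y * R = 1\<^sub>m k"
      using factors_one_sided_invertible(2)[OF kn km assms(8)] by (auto simp: Y_def)
    have "vec_space.rank n P \<le> k"
      by (rule rank_le_of_sum_of_products[OF P, where d = k and f = "\<lambda>i h. X $$ (i, h)"
            and g = "\<lambda>h j. Y $$ (h, j)"])
        (simp add: PXY mult_mat_index[OF X Y])
    then have "vec_space.rank n (N t) \<le> k" for t
      using rank_eq[of t] N[of t] P by (simp add: mat_rank_def)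
    from eventually_positive_factorization[OF lim[unfolded PXY] X Y posX posY L R this]
    show ?thesis
      by eventually_elim (auto intro!: nonneg_factorable_mult less_imp_le)
  qed
  have "\<forall>\<^sub>F t in sequentially. nonneg_rank (N t) = nonneg_rank P"
    using lower upper
  proof eventually_elim
    case (elim t)
    then show ?case using nonneg_rank_le_iff[OF nnN] assms(4) by (metis le_antisym)
  qed
  then show False using ne by (simp add: eventually_sequentially)
qed

end
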